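(* Let $n\ge 2$. The separability complex $\mathrm{SC}(\mathbf{R}_n)$ admits an $\mathrm{Out}(\mathbf{F}_n)$-action by isometries.
   Context: $\mathbf{F}_n$ is the free group on $X_n=\{x_1,\dots,x_n\}$, $\mathrm{Out}(\mathbf{F}_n)$ is its outer automorphism group, and $\mathbf{R}_n$ is the rose (the graph with one vertex and $n$ edges), with $\pi_1(\mathbf{R}_n)$ identified with $\mathbf{F}_n$. A proper free factor of $\mathbf{F}_n$ is a nontrivial proper subgroup $F$ such that $\mathbf{F}_n=F*G$ for some nontrivial proper subgroup $G$; $\mathcal{C}^{\mathrm{sep}}$ is the set of elements of $\mathbf{F}_n$ lying in some proper free factor (separable elements). The separability complex $\mathrm{SC}(\mathbf{R}_n)$ is the directed graph defined as follows. Its vertices are the conjugacy classes $[v]$ of elements $v\in\mathbf{F}_n$. Each edge is labeled by the conjugacy class $[\alpha]$ of a nontrivial element of $\mathcal{C}^{\mathrm{sep}}$; there is an edge labeled $[\alpha]$ from $[v]$ to $[w]$ whenever there are $\hat\alpha\in[\alpha]$, $\hat v\in[v]$, $\hat w\in[w]$ with $\hat w=\hat v\hat\alpha$ in $\mathbf{F}_n$. It carries the path metric in which every edge has length one. *)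

theory Defs
  imports
    "HOL-Algebra.Group_Action"
    "HOL-Library.Extended_Real"
    "Graph_Theory.Digraph"
begin

section \<open>Free groups\<close>

text \<open>
  A letter is a generator together with a sign: \<open>(x, True)\<close> stands for \<open>x\<close> and
  \<open>(x, False)\<close> for its inverse. Elements of the free group are the freely reduced words.
\<close>

type_synonym 'a letter = "'a \<times> bool"

definition letter_inv :: "'a letter \<Rightarrow> 'a letter" where
  "letter_inv a = (fst a, \<not> snd a)"

definition freely_reduced :: "'a letter list \<Rightarrow> bool" where
  "freely_reduced w \<longleftrightarrow> successively (\<lambda>a b. b \<noteq> letter_inv a) w"

fun push_letter :: "'a letter \<Rightarrow> 'a letter list \<Rightarrow> 'a letter list" where
  "push_letter a [] = [a]"
| "push_letter a (b # w) = (if b = letter_inv a then w else a # b # w)"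

definition free_reduction :: "'a letter list \<Rightarrow> 'a letter list" where
  "free_reduction w = foldr push_letter w []"

definition free_group :: "'a set \<Rightarrow> 'a letter list monoid" where
  "free_group X =
    \<lparr>carrier = {w. set w \<subseteq> X \<times> UNIV \<and> freely_reduced w},
     mult = (\<lambda>u v. free_reduction (u @ v)),
     one = []\<rparr>"

abbreviation F :: "nat \<Rightarrow> nat letter list monoid" where
  "F n \<equiv> free_group {1..n}"


section \<open>Outer automorphisms and conjugacy classes\<close>

definition conjugation :: "('g, 'm) monoid_scheme \<Rightarrow> 'g \<Rightarrow> 'g \<Rightarrow> 'g" where
  "conjugation G g = (\<lambda>h \<in> carrier G. g \<otimes>\<^bsub>G\<^esub> h \<otimes>\<^bsub>G\<^esub> inv\<^bsub>G\<^esub> g)"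

definition Inn :: "('g, 'm) monoid_scheme \<Rightarrow> ('g \<Rightarrow> 'g) set" where
  "Inn G = conjugation G ` carrier G"

definition Out :: "('g, 'm) monoid_scheme \<Rightarrow> ('g \<Rightarrow> 'g) set monoid" where
  "Out G = AutoGroup G Mod Inn G"

definition conj_class :: "('g, 'm) monoid_scheme \<Rightarrow> 'g \<Rightarrow> 'g set" where
  "conj_class G x = orbit G (conjugation G) x"


section \<open>Free products and free factors\<close>

text \<open>
  The free product of \<open>A\<close> and \<open>B\<close> consists of the alternating words in nontrivial elements of
  \<open>A\<close> (tagged \<open>Inl\<close>) and of \<open>B\<close> (tagged \<open>Inr\<close>). The product of two such words is their
  concatenation, in which neighbouring syllables of the same factor are multiplied together
  and trivial syllables dropped.
\<close>

fun push_syllable ::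
  "('a, 'm) monoid_scheme \<Rightarrow> ('b, 'k) monoid_scheme \<Rightarrow> 'a + 'b \<Rightarrow> ('a + 'b) list \<Rightarrow> ('a + 'b) list"
where
  "push_syllable A B (Inl a) (Inl a' # w) =
     (if a \<otimes>\<^bsub>A\<^esub> a' = \<one>\<^bsub>A\<^esub> then w else Inl (a \<otimes>\<^bsub>A\<^esub> a') # w)"
| "push_syllable A B (Inr b) (Inr b' # w) =
     (if b \<otimes>\<^bsub>B\<^esub> b' = \<one>\<^bsub>B\<^esub> then w else Inr (b \<otimes>\<^bsub>B\<^esub> b') # w)"
| "push_syllable A B s w = s # w"

definition free_product ::
  "('a, 'm) monoid_scheme \<Rightarrow> ('b, 'k) monoid_scheme \<Rightarrow> ('a + 'b) list monoid"
where
  "free_product A B =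
    \<lparr>carrier = {w. set w \<subseteq> Inl ` (carrier A - {\<one>\<^bsub>A\<^esub>}) \<union> Inr ` (carrier B - {\<one>\<^bsub>B\<^esub>})
                  \<and> successively (\<lambda>s t. isl s \<noteq> isl t) w},
     mult = (\<lambda>u v. foldr (push_syllable A B) u v),
     one = []\<rparr>"

definition eval_syllables :: "('g, 'm) monoid_scheme \<Rightarrow> ('g + 'g) list \<Rightarrow> 'g" where
  "eval_syllables G w = foldr (\<lambda>s g. case_sum id id s \<otimes>\<^bsub>G\<^esub> g) w \<one>\<^bsub>G\<^esub>"

text \<open>\<open>G = H * K\<close> for subgroups \<open>H\<close>, \<open>K\<close>: the homomorphism from the free product of \<open>H\<close> and
  \<open>K\<close> to \<open>G\<close> induced by the two inclusions is an isomorphism.\<close>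

definition is_internal_free_product ::
  "('g, 'm) monoid_scheme \<Rightarrow> 'g set \<Rightarrow> 'g set \<Rightarrow> bool"
where
  "is_internal_free_product G H K \<longleftrightarrow>
     subgroup H G \<and> subgroup K G \<and>
     eval_syllables G \<in> iso (free_product (G\<lparr>carrier := H\<rparr>) (G\<lparr>carrier := K\<rparr>)) G"

definition nontrivial_proper_subgroup :: "'g set \<Rightarrow> ('g, 'm) monoid_scheme \<Rightarrow> bool" where
  "nontrivial_proper_subgroup H G \<longleftrightarrow> subgroup H G \<and> H \<noteq> {\<one>\<^bsub>G\<^esub>} \<and> H \<noteq> carrier G"

definition proper_free_factor :: "'g set \<Rightarrow> ('g, 'm) monoid_scheme \<Rightarrow> bool" where
  "proper_free_factor H G \<longleftrightarrow>
     nontrivial_proper_subgroup H G \<and>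
     (\<exists>K. nontrivial_proper_subgroup K G \<and> is_internal_free_product G H K)"

definition separable_elements :: "('g, 'm) monoid_scheme \<Rightarrow> 'g set" where
  "separable_elements G = {x. \<exists>H. proper_free_factor H G \<and> x \<in> H}"


section \<open>The separability complex\<close>

text \<open>The arc \<open>(V, L, W)\<close> goes from the vertex \<open>V\<close> to the vertex \<open>W\<close> and has label \<open>L\<close>; there may be
  loops, and several arcs with different labels between the same two vertices.\<close>

definition separability_complex ::
  "('g, 'm) monoid_scheme \<Rightarrow> ('g set, 'g set \<times> 'g set \<times> 'g set) pre_digraph"
where
  "separability_complex G =
    \<lparr>verts = conj_class G ` carrier G,
     arcs = {(conj_class G v, conj_class G \<alpha>, conj_class G w) | v \<alpha> w.
               v \<in> carrier G \<and> w \<in> carrier G \<and>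
               \<alpha> \<in> separable_elements G \<and> \<alpha> \<noteq> \<one>\<^bsub>G\<^esub> \<and>
               (\<exists>\<alpha>' \<in> conj_class G \<alpha>. \<exists>v' \<in> conj_class G v. \<exists>w' \<in> conj_class G w.
                  w' = v' \<otimes>\<^bsub>G\<^esub> \<alpha>')},
     tail = (\<lambda>(V, L, W). V),
     head = (\<lambda>(V, L, W). W)\<rparr>"

abbreviation SC :: "nat \<Rightarrow>
  (nat letter list set, nat letter list set \<times> nat letter list set \<times> nat letter list set) pre_digraph"
where
  "SC n \<equiv> separability_complex (F n)"


section \<open>The path metric of a graph with edges of length one\<close>

datatype ('v, 'e) graph_point = Vertex 'v | Interior 'e real

text \<open>The point at parameter \<open>t\<close> (between 0 and 1) on the arc \<open>e\<close>, parametrized from tail to head.\<close>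

definition arc_point :: "('v, 'e) pre_digraph \<Rightarrow> 'e \<Rightarrow> real \<Rightarrow> ('v, 'e) graph_point" where
  "arc_point G e t =
     (if t = 0 then Vertex (tail G e) else if t = 1 then Vertex (head G e) else Interior e t)"

definition graph_points :: "('v, 'e) pre_digraph \<Rightarrow> ('v, 'e) graph_point set" where
  "graph_points G = Vertex ` verts G \<union> {Interior e t | e t. e \<in> arcs G \<and> 0 < t \<and> t < 1}"

text \<open>A piecewise linear path is given by its linear pieces \<open>(e, s, t)\<close>, each running along the arc
  \<open>e\<close> from parameter \<open>s\<close> to parameter \<open>t\<close>. Arcs may be traversed in both directions.\<close>

fun pl_path ::
  "('v, 'e) pre_digraph \<Rightarrow> ('v, 'e) graph_point \<Rightarrow> ('e \<times> real \<times> real) list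
     \<Rightarrow> ('v, 'e) graph_point \<Rightarrow> bool"
where
  "pl_path G x [] y \<longleftrightarrow> x \<in> graph_points G \<and> x = y"
| "pl_path G x ((e, s, t) # p) y \<longleftrightarrow>
     e \<in> arcs G \<and> s \<in> {0..1} \<and> t \<in> {0..1} \<and> x = arc_point G e s \<and> pl_path G (arc_point G e t) p y"

definition pl_length :: "('e \<times> real \<times> real) list \<Rightarrow> real" where
  "pl_length p = (\<Sum>(e, s, t) \<leftarrow> p. \<bar>s - t\<bar>)"

text \<open>The value is \<open>\<infinity>\<close> if there is no path from \<open>x\<close> to \<open>y\<close>.\<close>

definition path_dist ::
  "('v, 'e) pre_digraph \<Rightarrow> ('v, 'e) graph_point \<Rightarrow> ('v, 'e) graph_point \<Rightarrow> ereal"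
where
  "path_dist G x y = (INF p \<in> {p. pl_path G x p y}. ereal (pl_length p))"

definition acts_by_isometries ::
  "('h, 'm) monoid_scheme \<Rightarrow> ('v, 'e) pre_digraph
     \<Rightarrow> ('h \<Rightarrow> ('v, 'e) graph_point \<Rightarrow> ('v, 'e) graph_point) \<Rightarrow> bool"
where
  "acts_by_isometries H G act \<longleftrightarrow>
     group_action H (graph_points G) act \<and>
     (\<forall>h \<in> carrier H. \<forall>x \<in> graph_points G. \<forall>y \<in> graph_points G.
        path_dist G (act h x) (act h y) = path_dist G x y)"

end

theory Submission
  imports Defs
begin

text \<open>
  An automorphism maps conjugacy classes to conjugacy classes and free splittings to free
  splittings, hence separable elements to separable elements; so taking images of vertices and of
  arc labels is an automorphism of the separability complex. Inner automorphisms fix every conjugacy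
  class, so this action of the automorphism group factors through \<open>Out\<close>. A graph homomorphism maps
  paths to paths of the same length and hence does not increase distances; applying this to an
  automorphism and to its inverse shows that the action is isometric.
\<close>

section \<open>The group structure of free groups\<close>

lemma letter_inv_inv [simp]: "letter_inv (letter_inv a) = a"
  by (simp add: letter_inv_def)

lemma freely_reduced_push_letter:
  "freely_reduced w \<Longrightarrow> freely_reduced (push_letter a w)"
  by (cases w) (auto simp: freely_reduced_def successively_Cons)

text \<open>If \<open>w\<close> starts with \<open>a\<close>, the first push removes that letter and
  the second restores it. Reducedness enters here: the letter that follows is not the inverse of
  \<open>a\<close>, so the second push cannot cancel once more. Otherwise the inverse letter is put
  in front and removed at once.\<close>

lemma push_letter_cancel:
  assumes "freely_reduced w"
  shows "push_letter a (push_letter (letter_inv a) w) = w"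
proof (cases w)
  case (Cons b v)
  show ?thesis
    using assms unfolding Cons freely_reduced_def by (cases v) auto
qed auto

lemma freely_reduced_foldr_push:
  "freely_reduced w \<Longrightarrow> freely_reduced (foldr push_letter u w)"
  by (induction u) (auto intro: freely_reduced_push_letter)

lemma set_foldr_push: "set (foldr push_letter u w) \<subseteq> set u \<union> set w"
proof (induction u)
  case (Cons a u)
  have "set (push_letter a v) \<subseteq> insert a (set v)" for v
    by (cases v) auto
  with Cons show ?case by fastforce
qed auto

lemma foldr_push_id: "freely_reduced w \<Longrightarrow> foldr push_letter w [] = w"
proof (induction w)
  case (Cons a w)
  then show ?case by (cases w) (auto simp: freely_reduced_def)
qed auto

text \<open>The point is the case where \<open>a\<close> cancels the first letter of
  \<open>u\<close>. The right-hand side then pushes that letter and afterwards its inverse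
  \<open>a\<close>, which \<open>push_letter_cancel\<close> undoes.\<close>

lemma foldr_push_push:
  "freely_reduced w \<Longrightarrow>
    foldr push_letter (push_letter a u) w = push_letter a (foldr push_letter u w)"
  by (cases u) (auto simp: push_letter_cancel freely_reduced_foldr_push)

text \<open>Associativity by van der Waerden's argument: a letter and its inverse act on reduced
  words as mutually inverse permutations, so reducing a word does not change how it acts.\<close>

lemma foldr_push_foldr_push:
  "freely_reduced w \<Longrightarrow>
    foldr push_letter (foldr push_letter u v) w = foldr push_letter u (foldr push_letter v w)"
  by (induction u) (auto simp: foldr_push_push)

text \<open>\<open>foldr\<close> starts with the last entry, the inverse of the first letter of
  \<open>u\<close>, so cancellation eats up \<open>u\<close> from the front, one letter at a
  time.\<close>

lemma foldr_push_inverse: "foldr push_letter (rev (map letter_inv u)) u = []"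
proof (induction u)
  case (Cons a u)
  have "push_letter (letter_inv a) (a # u) = u" by simp
  with Cons show ?case by simp
qed auto

lemma mult_free_group:
  "freely_reduced v \<Longrightarrow> u \<otimes>\<^bsub>free_group X\<^esub> v = foldr push_letter u v"
  by (simp add: free_group_def free_reduction_def foldr_push_id)

lemma group_free_group: "group (free_group X)"
proof (rule groupI)
  show "\<one>\<^bsub>free_group X\<^esub> \<in> carrier (free_group X)"
    by (simp add: free_group_def freely_reduced_def)
next
  fix x y assume "x \<in> carrier (free_group X)" "y \<in> carrier (free_group X)"
  then have "set x \<subseteq> X \<times> UNIV" "set y \<subseteq> X \<times> UNIV" "freely_reduced y"
    by (auto simp: free_group_def)
  then have "foldr push_letter x y \<in> carrier (free_group X)"
    using set_foldr_push[of x y] by (auto simp: free_group_def freely_reduced_foldr_push)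
  with \<open>freely_reduced y\<close> show "x \<otimes>\<^bsub>free_group X\<^esub> y \<in> carrier (free_group X)"
    by (simp add: mult_free_group)
next
  fix x y z
  assume "x \<in> carrier (free_group X)" "y \<in> carrier (free_group X)" "z \<in> carrier (free_group X)"
  then have "freely_reduced y" "freely_reduced z"
    by (auto simp: free_group_def)
  then show "x \<otimes>\<^bsub>free_group X\<^esub> y \<otimes>\<^bsub>free_group X\<^esub> z = x \<otimes>\<^bsub>free_group X\<^esub> (y \<otimes>\<^bsub>free_group X\<^esub> z)"
    by (simp add: mult_free_group freely_reduced_foldr_push foldr_push_foldr_push)
next
  fix x assume "x \<in> carrier (free_group X)"
  then show "\<one>\<^bsub>free_group X\<^esub> \<otimes>\<^bsub>free_group X\<^esub> x = x"
    by (auto simp: free_group_def free_reduction_def foldr_push_id)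
next
  fix x assume x: "x \<in> carrier (free_group X)"
  define y where "y = rev (map letter_inv x)"
  have "freely_reduced y"
    using x unfolding y_def freely_reduced_def free_group_def
    by (auto simp: successively_map elim!: successively_mono)
  moreover have "set y \<subseteq> X \<times> UNIV"
    using x by (auto simp: y_def free_group_def letter_inv_def)
  ultimately have "y \<in> carrier (free_group X)"
    by (simp add: free_group_def)
  moreover have "y \<otimes>\<^bsub>free_group X\<^esub> x = \<one>\<^bsub>free_group X\<^esub>"
    using x by (subst mult_free_group) (auto simp: y_def foldr_push_inverse free_group_def)
  ultimately show "\<exists>y\<in>carrier (free_group X). y \<otimes>\<^bsub>free_group X\<^esub> x = \<one>\<^bsub>free_group X\<^esub>" by blast
qed


section \<open>Free factors under isomorphisms\<close>

abbreviation syllables :: "('a, 'm) monoid_scheme \<Rightarrow> ('b, 'k) monoid_scheme \<Rightarrow> ('a + 'b) set"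
  where "syllables A B \<equiv> Inl ` carrier A \<union> Inr ` carrier B"

lemma set_push_syllable:
  assumes "group A" "group B" "s \<in> syllables A B" "set w \<subseteq> syllables A B"
  shows "set (push_syllable A B s w) \<subseteq> syllables A B"
  using assms
  by (induction A B s w rule: push_syllable.induct)
     (auto intro!: imageI monoid.m_closed dest: group.is_monoid)

lemma set_foldr_push_syllable:
  assumes "group A" "group B" "set u \<subseteq> syllables A B" "set w \<subseteq> syllables A B"
  shows "set (foldr (push_syllable A B) u w) \<subseteq> syllables A B"
  using assms(3)
proof (induction u)
  case (Cons s u)
  then show ?case
    using set_push_syllable[OF assms(1,2), of s "foldr (push_syllable A B) u w"] by simp
qed (use assms in auto)

text \<open>The hypothesis on \<open>[s]\<close> encodes that \<open>s\<close> is a nontrivial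
  syllable. Merging it with the first syllable of \<open>w\<close> either deletes that syllable,
  leaving the tail of an alternating word, or replaces it by a nontrivial one of the same factor, so
  that alternation with the next syllable persists.\<close>

lemma push_syllable_in_free_product:
  assumes "group A" "group B" "[s] \<in> carrier (free_product A B)" "w \<in> carrier (free_product A B)"
  shows "push_syllable A B s w \<in> carrier (free_product A B)"
proof (cases w)
  case (Cons t v)
  then show ?thesis
    using assms
    by (cases s; cases t; cases v)
       (auto simp: free_product_def intro!: imageI monoid.m_closed dest: group.is_monoid)
qed (use assms in auto)

text \<open>Serves the transport of free splittings: there, two evaluations are known to agree only
  on words of the carrier, and this agreement has to be applied to a product.\<close>

lemma mult_in_free_product:
  assumes "group A" "group B" "u \<in> carrier (free_product A B)" "w \<in> carrier (free_product A B)"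
  shows "u \<otimes>\<^bsub>free_product A B\<^esub> w \<in> carrier (free_product A B)"
proof -
  have "set u \<subseteq> Inl ` (carrier A - {\<one>\<^bsub>A\<^esub>}) \<union> Inr ` (carrier B - {\<one>\<^bsub>B\<^esub>})"
    using assms(3) by (simp add: free_product_def)
  then have "foldr (push_syllable A B) u w \<in> carrier (free_product A B)"
  proof (induction u)
    case (Cons s u)
    then have "[s] \<in> carrier (free_product A B)"
      by (simp add: free_product_def)
    with Cons show ?case
      using push_syllable_in_free_product[OF assms(1,2)] by simp
  qed (use assms in simp)
  then show ?thesis by (simp add: free_product_def)
qed

section \<open>Functoriality of the free product for isomorphisms of the factors\<close>

locale free_product_iso =
  fixes A :: "('a, 'm) monoid_scheme" and B :: "('b, 'k) monoid_scheme"
    and A' :: "('c, 'm2) monoid_scheme" and B' :: "('d, 'k2) monoid_scheme"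
    and f g
  assumes groups: "group A" "group B" "group A'" "group B'"
    and isos: "f \<in> iso A A'" "g \<in> iso B B'"
begin

text \<open>Injectivity makes the tests for a trivial product in \<open>push_syllable\<close> come
  out alike before and after mapping. A homomorphism with a kernel would not commute with the
  reduction.\<close>

lemma eq_one_iff:
  "a \<in> carrier A \<Longrightarrow> f a = \<one>\<^bsub>A'\<^esub> \<longleftrightarrow> a = \<one>\<^bsub>A\<^esub>"
  "b \<in> carrier B \<Longrightarrow> g b = \<one>\<^bsub>B'\<^esub> \<longleftrightarrow> b = \<one>\<^bsub>B\<^esub>"
  using groups isos
  by (metis (no_types, lifting) Group.iso_iff group.is_monoid hom_one inj_onD monoid.one_closed)+

lemma map_push_syllable:
  assumes "s \<in> syllables A B" "set w \<subseteq> syllables A B"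
  shows "map (map_sum f g) (push_syllable A B s w) =
    push_syllable A' B' (map_sum f g s) (map (map_sum f g) w)"
proof -
  interpret A: group A by (rule groups)
  interpret B: group B by (rule groups)
  have f: "f (x \<otimes>\<^bsub>A\<^esub> y) = f x \<otimes>\<^bsub>A'\<^esub> f y" if "x \<in> carrier A" "y \<in> carrier A" for x y
    using isos that by (simp add: iso_def hom_mult)
  have g: "g (x \<otimes>\<^bsub>B\<^esub> y) = g x \<otimes>\<^bsub>B'\<^esub> g y" if "x \<in> carrier B" "y \<in> carrier B" for x y
    using isos that by (simp add: iso_def hom_mult)
  show ?thesis
  proof (cases w)
    case (Cons t v)
    then show ?thesis using assms
      by (auto simp flip: f g simp: eq_one_iff)
  qed (use assms in auto)
qed

lemma map_foldr_push_syllable: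
  assumes "set u \<subseteq> syllables A B" "set w \<subseteq> syllables A B"
  shows "map (map_sum f g) (foldr (push_syllable A B) u w) =
    foldr (push_syllable A' B') (map (map_sum f g) u) (map (map_sum f g) w)"
  using assms(1)
proof (induction u)
  case (Cons s u)
  then show ?case
    using set_foldr_push_syllable[OF groups(1,2), of u w] assms(2)
    by (simp add: map_push_syllable)
qed auto

lemma map_in_free_product:
  assumes "w \<in> carrier (free_product A B)"
  shows "map (map_sum f g) w \<in> carrier (free_product A' B')"
proof -
  have image: "map_sum f g s \<in> Inl ` (carrier A' - {\<one>\<^bsub>A'\<^esub>}) \<union> Inr ` (carrier B' - {\<one>\<^bsub>B'\<^esub>})"
    if "s \<in> Inl ` (carrier A - {\<one>\<^bsub>A\<^esub>}) \<union> Inr ` (carrier B - {\<one>\<^bsub>B\<^esub>})" for s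
    using that isos by (auto simp: iso_def hom_in_carrier eq_one_iff)
  have sub: "set w \<subseteq> Inl ` (carrier A - {\<one>\<^bsub>A\<^esub>}) \<union> Inr ` (carrier B - {\<one>\<^bsub>B\<^esub>})"
    using assms by (simp add: free_product_def)
  have "set (map (map_sum f g) w) \<subseteq>
      Inl ` (carrier A' - {\<one>\<^bsub>A'\<^esub>}) \<union> Inr ` (carrier B' - {\<one>\<^bsub>B'\<^esub>})"
    unfolding set_map by (intro image_subsetI image subsetD[OF sub])
  moreover have "successively (\<lambda>s t. isl s \<noteq> isl t) (map (map_sum f g) w)"
    using assms by (simp add: free_product_def successively_map isl_map_sum)
  ultimately show ?thesis
    unfolding free_product_def by (simp only: partial_object.simps mem_Collect_eq)
qed

text \<open>This symmetry yields bijectivity in \<open>map_iso\<close>: the syllablewise inverse map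
  also sends carrier to carrier, by \<open>map_in_free_product\<close> for the inverse
  isomorphisms.\<close>

lemma inverse: "free_product_iso A' B' A B (inv_into (carrier A) f) (inv_into (carrier B) g)"
  using groups isos group.iso_set_sym[OF groups(1) isos(1)] group.iso_set_sym[OF groups(2) isos(2)]
  by (intro free_product_iso.intro)

lemma map_iso: "map (map_sum f g) \<in> iso (free_product A B) (free_product A' B')"
proof (rule isoI)
  show "map (map_sum f g) \<in> hom (free_product A B) (free_product A' B')"
  proof (rule homI)
    fix u w assume "u \<in> carrier (free_product A B)" "w \<in> carrier (free_product A B)"
    then have "set u \<subseteq> syllables A B" "set w \<subseteq> syllables A B"
      by (auto simp: free_product_def)
    from map_foldr_push_syllable[OF this]
    show "map (map_sum f g) (u \<otimes>\<^bsub>free_product A B\<^esub> w) =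
      map (map_sum f g) u \<otimes>\<^bsub>free_product A' B'\<^esub> map (map_sum f g) w"
      by (simp add: free_product_def)
  qed (rule map_in_free_product)
next
  interpret inv: free_product_iso A' B' A B "inv_into (carrier A) f" "inv_into (carrier B) g"
    by (rule inverse)
  have bij: "bij_betw f (carrier A) (carrier A')" "bij_betw g (carrier B) (carrier B')"
    using isos by (auto simp: iso_def)
  show "bij_betw (map (map_sum f g)) (carrier (free_product A B)) (carrier (free_product A' B'))"
  proof (rule bij_betw_byWitness)
    show "\<forall>w\<in>carrier (free_product A B).
        map (map_sum (inv_into (carrier A) f) (inv_into (carrier B) g)) (map (map_sum f g) w) = w"
      using bij by (auto simp: free_product_def subset_iff bij_betw_inv_into_left intro!: map_idI)
    show "\<forall>w\<in>carrier (free_product A' B').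
        map (map_sum f g) (map (map_sum (inv_into (carrier A) f) (inv_into (carrier B) g)) w) = w"
      using bij by (auto simp: free_product_def subset_iff bij_betw_inv_into_right intro!: map_idI)
  qed (use map_in_free_product inv.map_in_free_product in auto)
qed

end

section \<open>Transport of free splittings and separable elements along isomorphisms\<close>

lemma eval_syllables_hom:
  assumes "group G" "group G'" "\<phi> \<in> hom G G'" "set w \<subseteq> syllables G G"
  shows "eval_syllables G w \<in> carrier G \<and>
    \<phi> (eval_syllables G w) = eval_syllables G' (map (map_sum \<phi> \<phi>) w)"
  using assms(4)
\<comment> \<open>Membership in the carrier is carried along because \<open>hom_mult\<close> needs
  it for the value of the tail.\<close>
proof (induction w)
  case Nil
  show ?case
    using assms(1-3) by (simp add: eval_syllables_def hom_one group.is_monoid)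
next
  case (Cons s w)
  then obtain g where "g \<in> carrier G" "s = Inl g \<or> s = Inr g"
    by auto
  with Cons show ?case
    using monoid.m_closed[OF group.is_monoid[OF assms(1)]] hom_mult[OF assms(3)]
    by (auto simp: eval_syllables_def)
qed

text \<open>A naturality square: applying \<phi> to every syllable and then evaluating in
  \<open>G'\<close> agrees with evaluating in \<open>G\<close> and then applying \<phi>. The
  syllablewise map and the composite \<phi> after evaluation are isomorphisms, hence so is the
  evaluation in \<open>G'\<close>.\<close>

lemma is_internal_free_product_iso:
  assumes G: "group G" and G': "group G'" and \<phi>: "\<phi> \<in> iso G G'"
    and HK: "is_internal_free_product G H K"
  shows "is_internal_free_product G' (\<phi> ` H) (\<phi> ` K)"
proof -
  have sub: "subgroup H G" "subgroup K G"
    and ev: "eval_syllables G \<in> iso (free_product (G\<lparr>carrier := H\<rparr>) (G\<lparr>carrier := K\<rparr>)) G"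
    using HK by (auto simp: is_internal_free_product_def)
  interpret group_hom G G' \<phi>
    using G G' \<phi> by (simp add: group_hom_def group_hom_axioms_def iso_def)
  have sub': "subgroup (\<phi> ` H) G'" "subgroup (\<phi> ` K) G'"
    using sub by (auto intro: subgroup_img_is_subgroup)
  have restr: "\<phi> \<in> iso (G\<lparr>carrier := J\<rparr>) (G'\<lparr>carrier := \<phi> ` J\<rparr>)" if "subgroup J G" for J
    using \<phi> subgroup.subset[OF that]
    by (auto simp: iso_def hom_def bij_betw_def subset_iff intro: inj_on_subset)
  let ?P = "free_product (G\<lparr>carrier := H\<rparr>) (G\<lparr>carrier := K\<rparr>)"
  let ?P' = "free_product (G'\<lparr>carrier := \<phi> ` H\<rparr>) (G'\<lparr>carrier := \<phi> ` K\<rparr>)"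
  let ?M = "map (map_sum \<phi> \<phi>)"
  interpret fp: free_product_iso "G\<lparr>carrier := H\<rparr>" "G\<lparr>carrier := K\<rparr>"
    "G'\<lparr>carrier := \<phi> ` H\<rparr>" "G'\<lparr>carrier := \<phi> ` K\<rparr>" \<phi> \<phi>
    using sub[THEN restr] sub[THEN subgroup.subgroup_is_group] sub'[THEN subgroup.subgroup_is_group] G G'
    by (intro free_product_iso.intro) blast+
  have M: "?M \<in> hom ?P ?P'" "bij_betw ?M (carrier ?P) (carrier ?P')"
    using fp.map_iso by (auto simp: iso_def)
  have eq: "eval_syllables G' (?M w) = \<phi> (eval_syllables G w)" if "w \<in> carrier ?P" for w
  proof -
    have "set w \<subseteq> Inl ` (H - {\<one>\<^bsub>G\<^esub>}) \<union> Inr ` (K - {\<one>\<^bsub>G\<^esub>})"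
      using that by (simp add: free_product_def)
    also have "\<dots> \<subseteq> syllables G G"
      using sub[THEN subgroup.subset] by (intro Un_mono image_mono) blast+
    finally show ?thesis using eval_syllables_hom[OF G G' homh] by simp
  qed
  have comp: "\<phi> \<circ> eval_syllables G \<in> iso ?P G'"
    using ev \<phi> by (rule iso_set_trans)
  have closed: "u \<otimes>\<^bsub>?P\<^esub> w \<in> carrier ?P" if "u \<in> carrier ?P" "w \<in> carrier ?P" for u w
    using fp.groups(1,2) that by (rule mult_in_free_product)
  have "bij_betw (eval_syllables G' \<circ> ?M) (carrier ?P) (carrier G')"
    using comp eq by (simp add: iso_def cong: bij_betw_cong)
  \<comment> \<open>The bijection \<open>?M\<close> is cancelled on the right.\<close>
  then have bij: "bij_betw (eval_syllables G') (carrier ?P') (carrier G')"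
    using bij_betw_comp_iff[OF M(2)] by blast
  have "eval_syllables G' \<in> hom ?P' G'"
  proof (rule homI)
    show "eval_syllables G' u \<in> carrier G'" if "u \<in> carrier ?P'" for u
      using bij that by (auto simp: bij_betw_def)
    \<comment> \<open>As \<open>?M\<close> is onto, words over the image factors are pulled back to
      \<open>?P\<close>, where \<open>comp\<close> is already known to be multiplicative.\<close>
    fix u' w' assume "u' \<in> carrier ?P'" "w' \<in> carrier ?P'"
    then have "u' \<in> ?M ` carrier ?P" "w' \<in> ?M ` carrier ?P"
      by (simp_all only: bij_betw_imp_surj_on[OF M(2)])
    then obtain u w where uw: "u \<in> carrier ?P" "w \<in> carrier ?P" "u' = ?M u" "w' = ?M w"
      by (elim imageE)
    have "eval_syllables G' (u' \<otimes>\<^bsub>?P'\<^esub> w') = eval_syllables G' (?M (u \<otimes>\<^bsub>?P\<^esub> w))"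
      using uw by (simp only: Group.hom_mult[OF M(1)])
    also have "\<dots> = \<phi> (eval_syllables G (u \<otimes>\<^bsub>?P\<^esub> w))"
      using eq closed uw by simp
    also have "\<dots> = \<phi> (eval_syllables G u) \<otimes>\<^bsub>G'\<^esub> \<phi> (eval_syllables G w)"
      using comp uw by (auto simp: iso_def hom_def)
    also have "\<dots> = eval_syllables G' u' \<otimes>\<^bsub>G'\<^esub> eval_syllables G' w'"
      using uw eq by simp
    finally show "eval_syllables G' (u' \<otimes>\<^bsub>?P'\<^esub> w') = \<dots>" .
  qed
  with bij sub' show ?thesis
    by (simp add: is_internal_free_product_def iso_def)
qed

lemma nontrivial_proper_subgroup_iso:
  assumes "group G" "group G'" "\<phi> \<in> iso G G'" "nontrivial_proper_subgroup H G"
  shows "nontrivial_proper_subgroup (\<phi> ` H) G'"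
proof -
  interpret group_hom G G' \<phi>
    using assms by (simp add: group_hom_def group_hom_axioms_def iso_def)
  have H: "subgroup H G" "H \<noteq> {\<one>\<^bsub>G\<^esub>}" "H \<noteq> carrier G"
    using assms by (auto simp: nontrivial_proper_subgroup_def)
  then have "subgroup (\<phi> ` H) G'"
    by (auto intro: subgroup_img_is_subgroup)
  moreover have "inj_on \<phi> (carrier G)" "\<phi> ` carrier G = carrier G'"
    using assms by (auto simp: iso_def bij_betw_def)
  \<comment> \<open>Since \<phi> is injective, distinct subsets of the carrier have distinct images.
    The instances used are the trivial subgroup and the whole group.\<close>
  then have "\<phi> ` H = \<phi> ` J \<longleftrightarrow> H = J" if "J \<subseteq> carrier G" for J
    using inj_on_image_eq_iff subgroup.subset[OF H(1)] that by metis
  from this[of "{\<one>\<^bsub>G\<^esub>}"] this[of "carrier G"]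
  have "\<phi> ` H \<noteq> {\<one>\<^bsub>G'\<^esub>}" "\<phi> ` H \<noteq> carrier G'"
    using H \<open>\<phi> ` carrier G = carrier G'\<close> by auto
  ultimately show ?thesis by (simp add: nontrivial_proper_subgroup_def)
qed

lemma separable_elements_iso:
  assumes "group G" "group G'" "\<phi> \<in> iso G G'" "x \<in> separable_elements G"
  shows "\<phi> x \<in> separable_elements G'"
proof -
  from assms(4) obtain H K where "x \<in> H" "nontrivial_proper_subgroup H G"
    "nontrivial_proper_subgroup K G" "is_internal_free_product G H K"
    by (auto simp: separable_elements_def proper_free_factor_def)
  then have "\<phi> x \<in> \<phi> ` H" "proper_free_factor (\<phi> ` H) G'"
    using nontrivial_proper_subgroup_iso is_internal_free_product_iso assms(1-3)
    unfolding proper_free_factor_def by blast+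
  then show ?thesis
    by (auto simp: separable_elements_def)
qed

lemma separable_elements_subset: "separable_elements G \<subseteq> carrier G"
  by (auto simp: separable_elements_def proper_free_factor_def nontrivial_proper_subgroup_def
      dest: subgroup.subset)


section \<open>Inner automorphisms\<close>

context group
begin

lemma conjugation_apply: "h \<in> carrier G \<Longrightarrow> conjugation G g h = g \<otimes> h \<otimes> inv g"
  by (simp add: conjugation_def)

lemma conjugation_compose:
  assumes "g \<in> carrier G" "h \<in> carrier G"
  shows "compose (carrier G) (conjugation G g) (conjugation G h) = conjugation G (g \<otimes> h)"
  using assms by (auto simp: fun_eq_iff compose_def conjugation_def inv_mult_group m_assoc)

text \<open>Members of \<open>auto G\<close> are extensional; the restriction to the carrier built
  into \<open>conjugation\<close> provides this.\<close>

lemma conjugation_auto: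
  assumes "g \<in> carrier G"
  shows "conjugation G g \<in> auto G"
proof -
  have "bij_betw (conjugation G g) (carrier G) (carrier G)"
    using assms
    by (intro bij_betw_byWitness[where f' = "conjugation G (inv g)"])
       (auto simp: conjugation_def m_assoc simp flip: m_assoc[of g "inv g"] m_assoc[of "inv g" g])
  moreover have "conjugation G g \<in> hom G G"
  proof (rule homI)
    fix x y assume "x \<in> carrier G" "y \<in> carrier G"
    then show "conjugation G g (x \<otimes> y) = conjugation G g x \<otimes> conjugation G g y"
      using assms by (simp add: conjugation_apply m_assoc inv_solve_left)
  qed (use assms in \<open>simp add: conjugation_def\<close>)
  ultimately show ?thesis
    by (auto simp: auto_def Bij_def conjugation_def)
qed

lemma carrier_AutoGroup: "carrier (AutoGroup G) = auto G"
  by (simp add: AutoGroup_def)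

lemma mult_AutoGroup:
  "\<phi> \<in> auto G \<Longrightarrow> \<psi> \<in> auto G \<Longrightarrow> \<phi> \<otimes>\<^bsub>AutoGroup G\<^esub> \<psi> = compose (carrier G) \<phi> \<psi>"
  by (simp add: AutoGroup_def BijGroup_def auto_def)

lemma one_AutoGroup: "\<one>\<^bsub>AutoGroup G\<^esub> = (\<lambda>x\<in>carrier G. x)"
  by (simp add: AutoGroup_def BijGroup_def)

lemma auto_iso: "\<phi> \<in> auto G \<Longrightarrow> \<phi> \<in> iso G G"
  by (simp add: auto_def iso_def Bij_def)

text \<open>This form avoids the inverse of \<phi> as a function; the inverse is brought in
  afterwards by a computation inside the group \<open>AutoGroup G\<close>.\<close>

lemma auto_conjugation:
  assumes "\<phi> \<in> auto G" "g \<in> carrier G"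
  shows "compose (carrier G) \<phi> (conjugation G g) = compose (carrier G) (conjugation G (\<phi> g)) \<phi>"
proof -
  interpret group_hom G G \<phi>
    using assms by unfold_locales (simp add: auto_def)
  show ?thesis
    using assms by (auto simp: fun_eq_iff compose_def conjugation_def)
qed

text \<open>\<open>Inn G\<close> is a subgroup as the image of the homomorphism
  \<open>conjugation G\<close> into \<open>AutoGroup G\<close>. By \<open>auto_conjugation\<close>,
  conjugating the inner automorphism of g by \<phi> gives that of \<phi>(g).\<close>

lemma Inn_normal: "Inn G \<lhd> AutoGroup G"
proof -
  interpret Aut: group "AutoGroup G" by (rule AutoGroup)
  have "group_hom G (AutoGroup G) (conjugation G)"
    by unfold_locales
       (auto intro!: homI simp: carrier_AutoGroup conjugation_auto mult_AutoGroup conjugation_compose)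
  then have "subgroup (Inn G) (AutoGroup G)"
    unfolding Inn_def by (rule group_hom.img_is_subgroup)
  moreover have "\<phi> \<otimes>\<^bsub>AutoGroup G\<^esub> \<iota> \<otimes>\<^bsub>AutoGroup G\<^esub> inv\<^bsub>AutoGroup G\<^esub> \<phi> \<in> Inn G"
    if "\<phi> \<in> auto G" "\<iota> \<in> Inn G" for \<phi> \<iota>
  proof -
    from that obtain g where g: "g \<in> carrier G" "\<iota> = conjugation G g"
      by (auto simp: Inn_def)
    have g': "\<phi> g \<in> carrier G"
      using that g by (auto simp: auto_def hom_in_carrier)
    have "\<phi> \<otimes>\<^bsub>AutoGroup G\<^esub> \<iota> = conjugation G (\<phi> g) \<otimes>\<^bsub>AutoGroup G\<^esub> \<phi>"
      using that g g' by (simp add: mult_AutoGroup conjugation_auto auto_conjugation)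
    then have "\<phi> \<otimes>\<^bsub>AutoGroup G\<^esub> \<iota> \<otimes>\<^bsub>AutoGroup G\<^esub> inv\<^bsub>AutoGroup G\<^esub> \<phi> = conjugation G (\<phi> g)"
      using Aut.m_assoc[of "conjugation G (\<phi> g)" \<phi> "inv\<^bsub>AutoGroup G\<^esub> \<phi>"]
        Aut.r_inv[of \<phi>] Aut.inv_closed[of \<phi>] Aut.r_one[of "conjugation G (\<phi> g)"]
      using that g' by (simp only: carrier_AutoGroup conjugation_auto)
    with g' show ?thesis by (auto simp: Inn_def)
  qed
  ultimately show ?thesis
    by (simp add: Aut.normal_inv_iff carrier_AutoGroup)
qed

lemma auto_inverse:
  assumes "\<phi> \<in> auto G"
  obtains \<psi> where "\<psi> \<in> auto G"
    "compose (carrier G) \<psi> \<phi> = (\<lambda>x\<in>carrier G. x)" "compose (carrier G) \<phi> \<psi> = (\<lambda>x\<in>carrier G. x)"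
proof
  interpret Aut: group "AutoGroup G" by (rule AutoGroup)
  let ?\<psi> = "inv\<^bsub>AutoGroup G\<^esub> \<phi>"
  show \<psi>: "?\<psi> \<in> auto G"
    using assms Aut.inv_closed by (simp add: carrier_AutoGroup)
  show "compose (carrier G) ?\<psi> \<phi> = (\<lambda>x\<in>carrier G. x)" "compose (carrier G) \<phi> ?\<psi> = (\<lambda>x\<in>carrier G. x)"
    using assms \<psi> Aut.l_inv[of \<phi>] Aut.r_inv[of \<phi>]
    by (simp_all add: carrier_AutoGroup mult_AutoGroup one_AutoGroup)
qed

section \<open>Conjugacy classes and their images under automorphisms\<close>

lemma conj_class_eq: "x \<in> carrier G \<Longrightarrow> conj_class G x = {g \<otimes> x \<otimes> inv g | g. g \<in> carrier G}"
  by (simp add: conj_class_def orbit_def conjugation_def)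

lemma conj_class_subset: "x \<in> carrier G \<Longrightarrow> conj_class G x \<subseteq> carrier G"
  by (auto simp: conj_class_eq)

text \<open>\<phi> turns conjugation by g into conjugation by \<phi>(g), and surjectivity lets
  \<phi>(g) run through the whole group.\<close>

lemma image_conj_class:
  assumes "\<phi> \<in> auto G" "x \<in> carrier G"
  shows "\<phi> ` conj_class G x = conj_class G (\<phi> x)"
proof -
  interpret group_hom G G \<phi>
    using assms by unfold_locales (simp add: auto_def)
  have surj: "\<phi> ` carrier G = carrier G"
    using assms by (simp add: auto_def Bij_def bij_betw_def)
  have "conj_class G (\<phi> x) = (\<lambda>g. g \<otimes> \<phi> x \<otimes> inv g) ` \<phi> ` carrier G"
    using assms by (auto simp: conj_class_eq surj)
  also have "\<dots> = \<phi> ` conj_class G x"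
    using assms by (simp add: conj_class_eq Setcompr_eq_image image_image)
  finally show ?thesis by simp
qed

text \<open>Conjugating first by g and then by h is conjugating by hg, and right translation by g
  permutes the group.\<close>

lemma conj_class_conjugation:
  assumes "g \<in> carrier G" "x \<in> carrier G"
  shows "conj_class G (conjugation G g x) = conj_class G x"
proof -
  have "conj_class G (conjugation G g x) = (\<lambda>h. h \<otimes> x \<otimes> inv h) ` (\<lambda>h. h \<otimes> g) ` carrier G"
    using assms unfolding image_image
    by (auto simp: conj_class_eq conjugation_apply Setcompr_eq_image inv_mult_group m_assoc)
  also have "(\<lambda>h. h \<otimes> g) ` carrier G = carrier G"
    using assms by (auto simp: image_iff) (metis inv_closed inv_solve_right m_closed)
  finally show ?thesis
    using assms by (auto simp: conj_class_eq)
qed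

end


section \<open>Path distance and graph homomorphisms\<close>

lemma arc_point_in_graph_points:
  assumes "e \<in> arcs G" "tail G e \<in> verts G" "head G e \<in> verts G" "t \<in> {0..1}"
  shows "arc_point G e t \<in> graph_points G"
  using assms by (auto simp: arc_point_def graph_points_def)

locale digraph_hom =
  fixes G :: "('v, 'e) pre_digraph" and H :: "('w, 'f) pre_digraph" and fv fe
  assumes verts: "v \<in> verts G \<Longrightarrow> fv v \<in> verts H"
    and arcs: "e \<in> arcs G \<Longrightarrow> fe e \<in> arcs H"
    and tail: "e \<in> arcs G \<Longrightarrow> tail H (fe e) = fv (tail G e)"
    and head: "e \<in> arcs G \<Longrightarrow> head H (fe e) = fv (head G e)"
begin

lemma map_in_graph_points: "x \<in> graph_points G \<Longrightarrow> map_graph_point fv fe x \<in> graph_points H"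
  using verts arcs by (auto simp: graph_points_def)

lemma map_arc_point:
  "e \<in> arcs G \<Longrightarrow> map_graph_point fv fe (arc_point G e t) = arc_point H (fe e) t"
  by (simp add: arc_point_def tail head)

lemma map_pl_path:
  "pl_path G x p y \<Longrightarrow>
    pl_path H (map_graph_point fv fe x) (map (apfst fe) p) (map_graph_point fv fe y)"
proof (induction p arbitrary: x)
  case (Cons a p)
  then show ?case
    by (cases a) (fastforce simp: map_arc_point arcs)
qed (auto simp: map_in_graph_points)

text \<open>The image of a path keeps all its parameters and hence its length, so the infimum on the
  left ranges over at least the lengths occurring on the right. Without a path from x to y the right
  side is infinite.\<close>

lemma path_dist_map_le:
  "path_dist H (map_graph_point fv fe x) (map_graph_point fv fe y) \<le> path_dist G x y"
proof -
  have "pl_length (map (apfst fe) p) = pl_length p" for p :: "('e \<times> real \<times> real) list"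
    by (induction p) (auto simp: pl_length_def)
  then show ?thesis
    unfolding path_dist_def using map_pl_path
    by (intro INF_mono) (metis mem_Collect_eq order_refl)
qed

end


section \<open>The action on the separability complex\<close>

definition map_arc :: "('g \<Rightarrow> 'h) \<Rightarrow> 'g set \<times> 'g set \<times> 'g set \<Rightarrow> 'h set \<times> 'h set \<times> 'h set" where
  "map_arc \<phi> = map_prod (image \<phi>) (map_prod (image \<phi>) (image \<phi>))"

text \<open>Defined for functions on group elements instead of outer classes; independence of the
  representative is obtained later from the triviality of inner automorphisms on conjugacy
  classes.\<close>

definition map_point ::
  "('g \<Rightarrow> 'h) \<Rightarrow> ('g set, 'g set \<times> 'g set \<times> 'g set) graph_point
    \<Rightarrow> ('h set, 'h set \<times> 'h set \<times> 'h set) graph_point"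
where
  "map_point \<phi> = map_graph_point (image \<phi>) (map_arc \<phi>)"

context group
begin

text \<open>Adds to the definition of arcs that \<alpha> lies in the carrier, as needed to compute
  the image of its class.\<close>

lemma arc_cases:
  assumes "e \<in> arcs (separability_complex G)"
  obtains v \<alpha> w where "e = (conj_class G v, conj_class G \<alpha>, conj_class G w)"
    "v \<in> carrier G" "\<alpha> \<in> carrier G" "w \<in> carrier G"
    "\<alpha> \<in> separable_elements G" "\<alpha> \<noteq> \<one>"
    "\<exists>\<alpha>'\<in>conj_class G \<alpha>. \<exists>v'\<in>conj_class G v. \<exists>w'\<in>conj_class G w. w' = v' \<otimes> \<alpha>'"
proof -
  from assms obtain v \<alpha> w where *: "e = (conj_class G v, conj_class G \<alpha>, conj_class G w)"
    "v \<in> carrier G" "w \<in> carrier G" "\<alpha> \<in> separable_elements G" "\<alpha> \<noteq> \<one>"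
    "\<exists>\<alpha>'\<in>conj_class G \<alpha>. \<exists>v'\<in>conj_class G v. \<exists>w'\<in>conj_class G w. w' = v' \<otimes> \<alpha>'"
    unfolding separability_complex_def by force
  have "\<alpha> \<in> carrier G"
    using *(4) by (rule subsetD[OF separable_elements_subset])
  with * show thesis
    by (intro that)
qed

lemma map_arc_conj_class:
  assumes "\<phi> \<in> auto G" "v \<in> carrier G" "\<alpha> \<in> carrier G" "w \<in> carrier G"
  shows "map_arc \<phi> (conj_class G v, conj_class G \<alpha>, conj_class G w) =
    (conj_class G (\<phi> v), conj_class G (\<phi> \<alpha>), conj_class G (\<phi> w))"
  using assms by (simp add: map_arc_def image_conj_class)

lemma digraph_hom_auto:
  assumes \<phi>: "\<phi> \<in> auto G"
  shows "digraph_hom (separability_complex G) (separability_complex G) (image \<phi>) (map_arc \<phi>)"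
proof
  interpret group_hom G G \<phi>
    using assms by unfold_locales (simp add: auto_def)
  show "\<phi> ` V \<in> verts (separability_complex G)" if "V \<in> verts (separability_complex G)" for V
    using that \<phi> by (auto simp: separability_complex_def image_conj_class)
  fix e assume "e \<in> arcs (separability_complex G)"
  then obtain v \<alpha> w where e: "e = (conj_class G v, conj_class G \<alpha>, conj_class G w)"
    and c: "v \<in> carrier G" "\<alpha> \<in> carrier G" "w \<in> carrier G"
    and \<alpha>: "\<alpha> \<in> separable_elements G" "\<alpha> \<noteq> \<one>"
    and ex: "\<exists>\<alpha>'\<in>conj_class G \<alpha>. \<exists>v'\<in>conj_class G v. \<exists>w'\<in>conj_class G w. w' = v' \<otimes> \<alpha>'"
    by (rule arc_cases)
  from ex obtain \<alpha>' v' where av: "\<alpha>' \<in> conj_class G \<alpha>" "v' \<in> conj_class G v"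
    "v' \<otimes> \<alpha>' \<in> conj_class G w" by blast
  \<comment> \<open>The images of the representatives that witness the old arc will witness the new
    one.\<close>
  have "\<phi> \<alpha>' \<in> conj_class G (\<phi> \<alpha>)" "\<phi> v' \<in> conj_class G (\<phi> v)"
    "\<phi> (v' \<otimes> \<alpha>') \<in> conj_class G (\<phi> w)"
    using av c \<phi> by (auto simp flip: image_conj_class)
  moreover have "\<phi> (v' \<otimes> \<alpha>') = \<phi> v' \<otimes> \<phi> \<alpha>'"
    using av c conj_class_subset by (intro hom_mult) auto
  moreover have "\<phi> \<alpha> \<noteq> \<one>"
    using auto_iso[OF \<phi>] \<alpha> c by (metis Group.iso_iff hom_one inj_onD one_closed)
  moreover have "\<phi> \<alpha> \<in> separable_elements G"
    using separable_elements_iso[OF is_group is_group auto_iso[OF \<phi>]] \<alpha> by blast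
  ultimately show "map_arc \<phi> e \<in> arcs (separability_complex G)"
    unfolding e map_arc_conj_class[OF \<phi> c] using c hom_closed
    unfolding separability_complex_def by fastforce
  show "tail (separability_complex G) (map_arc \<phi> e) = \<phi> ` tail (separability_complex G) e"
    "head (separability_complex G) (map_arc \<phi> e) = \<phi> ` head (separability_complex G) e"
    unfolding e by (simp_all add: separability_complex_def map_arc_def)
qed

text \<open>For an interior point only the three classes of its arc are retained, because
  \<open>map_point\<close> acts through them alone.\<close>

lemma point_cases:
  assumes "x \<in> graph_points (separability_complex G)"
  obtains v where "v \<in> carrier G" "x = Vertex (conj_class G v)"
  | v \<alpha> w t where "v \<in> carrier G" "\<alpha> \<in> carrier G" "w \<in> carrier G"
      "x = Interior (conj_class G v, conj_class G \<alpha>, conj_class G w) t"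
  using assms unfolding graph_points_def
  by (auto elim!: arc_cases) (auto simp: separability_complex_def)

text \<open>Phrased through conjugacy classes so as to cover both the identity and all inner
  automorphisms.\<close>

lemma map_point_id:
  assumes "x \<in> graph_points (separability_complex G)"
    and "\<And>v. v \<in> carrier G \<Longrightarrow> \<phi> ` conj_class G v = conj_class G v"
  shows "map_point \<phi> x = x"
  using assms(1) by (cases x rule: point_cases) (auto simp: map_point_def map_arc_def assms(2))

lemma map_point_restrict_id:
  "x \<in> graph_points (separability_complex G) \<Longrightarrow> map_point (\<lambda>x\<in>carrier G. x) x = x"
  by (rule map_point_id) (use conj_class_subset in force)+

text \<open>Conjugacy classes lie in the carrier, where the restricted composition used in
  \<open>AutoGroup\<close> agrees with the ordinary one.\<close>

lemma map_point_compose: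
  assumes "x \<in> graph_points (separability_complex G)"
  shows "map_point (compose (carrier G) \<phi> \<psi>) x = map_point \<phi> (map_point \<psi> x)"
proof -
  have "compose (carrier G) \<phi> \<psi> ` conj_class G v = \<phi> ` \<psi> ` conj_class G v" if "v \<in> carrier G" for v
    using conj_class_subset[OF that] by (auto simp: image_image compose_def intro!: image_cong)
  with assms show ?thesis
    by (elim point_cases) (simp_all add: map_point_def map_arc_def)
qed

lemma map_point_in:
  "\<phi> \<in> auto G \<Longrightarrow> x \<in> graph_points (separability_complex G) \<Longrightarrow>
    map_point \<phi> x \<in> graph_points (separability_complex G)"
  unfolding map_point_def by (rule digraph_hom.map_in_graph_points[OF digraph_hom_auto])

lemma map_point_isometry:
  assumes "\<phi> \<in> auto G"
    and x: "x \<in> graph_points (separability_complex G)" and y: "y \<in> graph_points (separability_complex G)"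
  shows "path_dist (separability_complex G) (map_point \<phi> x) (map_point \<phi> y) =
    path_dist (separability_complex G) x y"
proof (rule antisym)
  obtain \<psi> where \<psi>: "\<psi> \<in> auto G" "compose (carrier G) \<psi> \<phi> = (\<lambda>x\<in>carrier G. x)"
    using auto_inverse[OF assms(1)] by metis
  have le: "path_dist (separability_complex G) (map_point \<chi> a) (map_point \<chi> b) \<le>
      path_dist (separability_complex G) a b" if "\<chi> \<in> auto G" for \<chi> a b
    unfolding map_point_def by (rule digraph_hom.path_dist_map_le[OF digraph_hom_auto[OF that]])
  show "path_dist (separability_complex G) (map_point \<phi> x) (map_point \<phi> y) \<le>
    path_dist (separability_complex G) x y"
    using assms(1) by (rule le)
  have "map_point \<psi> (map_point \<phi> z) = z" if "z \<in> graph_points (separability_complex G)" for z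
    using that map_point_compose[OF that, of \<psi> \<phi>] \<psi> by (simp add: map_point_restrict_id)
  then show "path_dist (separability_complex G) x y \<le>
    path_dist (separability_complex G) (map_point \<phi> x) (map_point \<phi> y)"
    using le[OF \<psi>(1), of "map_point \<phi> x" "map_point \<phi> y"] x y by simp
qed

section \<open>The permutation action of automorphisms and its passage to outer
  automorphisms\<close>

lemma map_point_Bij:
  assumes "\<phi> \<in> auto G"
  shows "restrict (map_point \<phi>) (graph_points (separability_complex G))
    \<in> Bij (graph_points (separability_complex G))"
proof -
  let ?E = "graph_points (separability_complex G)"
  obtain \<psi> where \<psi>: "\<psi> \<in> auto G" "compose (carrier G) \<psi> \<phi> = (\<lambda>x\<in>carrier G. x)"
    "compose (carrier G) \<phi> \<psi> = (\<lambda>x\<in>carrier G. x)"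
    using auto_inverse[OF assms] by metis
  have "map_point \<psi> (map_point \<phi> z) = z" "map_point \<phi> (map_point \<psi> z) = z" if "z \<in> ?E" for z
    using that map_point_compose[OF that, of \<psi> \<phi>] map_point_compose[OF that, of \<phi> \<psi>] \<psi>
    by (simp_all add: map_point_restrict_id)
  then have "bij_betw (map_point \<phi>) ?E ?E"
    using map_point_in \<psi>(1) assms by (intro bij_betw_byWitness[where f' = "map_point \<psi>"]) auto
  \<comment> \<open>\<open>Bij\<close> also demands extensionality, which is why
    \<open>map_point\<close> is restricted to the points of the graph.\<close>
  then show ?thesis
    by (simp add: Bij_def)
qed

lemma map_point_group_hom:
  "group_hom (AutoGroup G) (BijGroup (graph_points (separability_complex G)))
    (\<lambda>\<phi>. restrict (map_point \<phi>) (graph_points (separability_complex G)))"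
proof -
  have "restrict (map_point (compose (carrier G) \<phi> \<psi>)) (graph_points (separability_complex G)) =
      compose (graph_points (separability_complex G))
        (restrict (map_point \<phi>) (graph_points (separability_complex G)))
        (restrict (map_point \<psi>) (graph_points (separability_complex G)))"
    if "\<phi> \<in> auto G" "\<psi> \<in> auto G" for \<phi> \<psi>
    using that by (auto simp: fun_eq_iff compose_def map_point_in map_point_compose[unfolded compose_def])
  then show ?thesis
    by (auto intro!: group_hom.intro group_hom_axioms.intro homI AutoGroup group_BijGroup
        simp: carrier_AutoGroup mult_AutoGroup)
       (auto simp: BijGroup_def map_point_Bij)
qed

lemma Inn_subset_kernel:
  "Inn G \<subseteq> kernel (AutoGroup G) (BijGroup (graph_points (separability_complex G)))
    (\<lambda>\<phi>. restrict (map_point \<phi>) (graph_points (separability_complex G)))"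
proof
  fix \<phi> assume "\<phi> \<in> Inn G"
  then obtain g where g: "g \<in> carrier G" "\<phi> = conjugation G g"
    by (auto simp: Inn_def)
  have "map_point \<phi> x = x" if "x \<in> graph_points (separability_complex G)" for x
    using that
    by (rule map_point_id) (simp add: g image_conj_class conjugation_auto conj_class_conjugation)
  then show "\<phi> \<in> kernel (AutoGroup G) (BijGroup (graph_points (separability_complex G)))
    (\<lambda>\<phi>. restrict (map_point \<phi>) (graph_points (separability_complex G)))"
    using g by (auto simp: kernel_def carrier_AutoGroup conjugation_auto BijGroup_def)
qed

text \<open>An element of \<open>Out G\<close> is a coset \<Phi> of \<open>Inn G\<close>. Giving the
  formula for every \<phi> in \<Phi> expresses that the choice of representative does not
  matter.\<close>

lemma Out_action:
  obtains act where "acts_by_isometries (Out G) (separability_complex G) act"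
    "\<forall>\<Phi>\<in>carrier (Out G). \<forall>\<phi>\<in>\<Phi>. \<phi> \<in> auto G"
    "\<forall>\<Phi>\<in>carrier (Out G). \<forall>\<phi>\<in>\<Phi>. \<forall>x\<in>graph_points (separability_complex G).
      act \<Phi> x = map_point \<phi> x"
proof -
  let ?E = "graph_points (separability_complex G)"
  interpret ker: group_hom "AutoGroup G" "BijGroup ?E" "\<lambda>\<phi>. restrict (map_point \<phi>) ?E"
    by (rule map_point_group_hom)
  interpret Inn: normal "Inn G" "AutoGroup G"
    by (rule Inn_normal)
  \<comment> \<open>Universal property of the quotient: the permutation representation kills
    \<open>Inn G\<close>, so it factors through \<open>Out G\<close>.\<close>
  obtain act where act: "act \<in> hom (Out G) (BijGroup ?E)"
    "\<And>\<phi>. \<phi> \<in> auto G \<Longrightarrow> act (Inn G #>\<^bsub>AutoGroup G\<^esub> \<phi>) = restrict (map_point \<phi>) ?E"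
    using ker.FactGroup_universal_kernel[OF Inn_normal Inn_subset_kernel]
    unfolding Out_def carrier_AutoGroup by metis
  have Out: "group (Out G)"
    unfolding Out_def by (rule Inn.factorgroup_is_group)
  \<comment> \<open>Every member of a coset represents it, so the formula for \<open>act\<close> on
    cosets applies to any \<phi> in \<Phi>.\<close>
  have coset: "\<phi> \<in> auto G \<and> \<Phi> = Inn G #>\<^bsub>AutoGroup G\<^esub> \<phi>"
    if \<Phi>: "\<Phi> \<in> carrier (Out G)" "\<phi> \<in> \<Phi>" for \<Phi> \<phi>
  proof -
    from \<Phi>(1) obtain \<psi> where "\<psi> \<in> auto G" "\<Phi> = Inn G #>\<^bsub>AutoGroup G\<^esub> \<psi>"
      by (auto simp: Out_def carrier_FactGroup carrier_AutoGroup)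
    with \<Phi>(2) show ?thesis
      using ker.G.repr_independence[OF _ _ Inn.subgroup_axioms] ker.G.r_coset_subset_G[OF Inn.subset]
      by (simp add: carrier_AutoGroup subset_iff)
  qed
  have act_eq: "act \<Phi> x = map_point \<phi> x"
    if "\<Phi> \<in> carrier (Out G)" "\<phi> \<in> \<Phi>" "x \<in> ?E" for \<Phi> \<phi> x
  proof -
    have "act \<Phi> = restrict (map_point \<phi>) ?E"
      using coset[OF that(1,2)] act(2)[of \<phi>] by simp
    with that(3) show ?thesis by simp
  qed
  have iso: "path_dist (separability_complex G) (act \<Phi> x) (act \<Phi> y) =
      path_dist (separability_complex G) x y"
    if "\<Phi> \<in> carrier (Out G)" "x \<in> ?E" "y \<in> ?E" for \<Phi> x y
  proof -
    from that(1) obtain \<psi> where \<psi>: "\<psi> \<in> auto G" "\<Phi> = Inn G #>\<^bsub>AutoGroup G\<^esub> \<psi>"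
      by (auto simp: Out_def carrier_FactGroup carrier_AutoGroup)
    \<comment> \<open>A coset contains its representative, so \<open>act_eq\<close> reduces the
      isometry claim to \<open>map_point\<close>.\<close>
    then have "\<psi> \<in> \<Phi>"
      using ker.G.rcos_self[OF _ Inn.subgroup_axioms] by (simp add: carrier_AutoGroup)
    with that \<psi>(1) show ?thesis
      by (simp add: act_eq map_point_isometry)
  qed
  have "group_action (Out G) ?E act"
    using act(1) Out group_BijGroup
    by (simp add: group_action_def group_hom_def group_hom_axioms_def)
  with iso have "acts_by_isometries (Out G) (separability_complex G) act"
    by (simp add: acts_by_isometries_def)
  with coset act_eq show thesis
    by (intro that[of act]) simp_all
qed

text \<open>Vertices and points on arcs exhaust the graph, so the explicit formulas determine the
  action and identify it as the natural one on conjugacy classes.\<close>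

theorem Out_acts_on_separability_complex:
  "\<exists>act. acts_by_isometries (Out G) (separability_complex G) act \<and>
    (\<forall>\<Phi> \<in> carrier (Out G). \<forall>\<phi> \<in> \<Phi>.
      (\<forall>v \<in> carrier G.
         act \<Phi> (Vertex (conj_class G v)) = Vertex (conj_class G (\<phi> v))) \<and>
      (\<forall>v \<in> carrier G. \<forall>\<alpha> \<in> carrier G. \<forall>w \<in> carrier G.
         (conj_class G v, conj_class G \<alpha>, conj_class G w) \<in> arcs (separability_complex G) \<longrightarrow>
           (conj_class G (\<phi> v), conj_class G (\<phi> \<alpha>), conj_class G (\<phi> w)) \<in> arcs (separability_complex G) \<and>
           (\<forall>t \<in> {0..1}.
              act \<Phi> (arc_point (separability_complex G) (conj_class G v, conj_class G \<alpha>, conj_class G w) t) =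
              arc_point (separability_complex G) (conj_class G (\<phi> v), conj_class G (\<phi> \<alpha>), conj_class G (\<phi> w)) t)))"
proof -
  obtain act where act: "acts_by_isometries (Out G) (separability_complex G) act"
    and auto: "\<forall>\<Phi>\<in>carrier (Out G). \<forall>\<phi>\<in>\<Phi>. \<phi> \<in> auto G"
    and act_eq: "\<forall>\<Phi>\<in>carrier (Out G). \<forall>\<phi>\<in>\<Phi>. \<forall>x\<in>graph_points (separability_complex G). act \<Phi> x = map_point \<phi> x"
    by (rule Out_action)
  show ?thesis
  proof (intro exI conjI ballI impI)
    show "acts_by_isometries (Out G) (separability_complex G) act" by (rule act)
  next
    fix \<Phi> \<phi> assume \<Phi>: "\<Phi> \<in> carrier (Out G)" "\<phi> \<in> \<Phi>"
    with auto have \<phi>: "\<phi> \<in> auto G" by blast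
    interpret hom: digraph_hom "separability_complex G" "separability_complex G" "image \<phi>" "map_arc \<phi>"
      using \<phi> by (rule digraph_hom_auto)
    fix v assume v: "v \<in> carrier G"
    then have "Vertex (conj_class G v) \<in> graph_points (separability_complex G)"
      by (simp add: graph_points_def separability_complex_def)
    with \<Phi> v show "act \<Phi> (Vertex (conj_class G v)) = Vertex (conj_class G (\<phi> v))"
      by (simp add: act_eq map_point_def image_conj_class \<phi>)
    fix \<alpha> w assume c: "\<alpha> \<in> carrier G" "w \<in> carrier G"
      and e: "(conj_class G v, conj_class G \<alpha>, conj_class G w) \<in> arcs (separability_complex G)" (is "?e \<in> _")
    have map_e: "map_arc \<phi> ?e = (conj_class G (\<phi> v), conj_class G (\<phi> \<alpha>), conj_class G (\<phi> w))"
      using \<phi> v c by (rule map_arc_conj_class)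
    show "(conj_class G (\<phi> v), conj_class G (\<phi> \<alpha>), conj_class G (\<phi> w)) \<in> arcs (separability_complex G)"
      using hom.arcs[OF e] by (simp add: map_e)
    fix t :: real assume "t \<in> {0..1}"
    then have "arc_point (separability_complex G) ?e t \<in> graph_points (separability_complex G)"
      using e v c by (intro arc_point_in_graph_points) (auto simp: separability_complex_def)
    then show "act \<Phi> (arc_point (separability_complex G) ?e t) =
        arc_point (separability_complex G) (conj_class G (\<phi> v), conj_class G (\<phi> \<alpha>), conj_class G (\<phi> w)) t"
      using \<Phi> hom.map_arc_point[OF e] by (simp add: act_eq map_point_def map_e)
  qed
qed

end

theorem proposition3p7:
  fixes n :: nat
  assumes "n \<ge> 2"
  shows "\<exists>act. acts_by_isometries (Out (F n)) (SC n) act \<and>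
    (\<forall>\<Phi> \<in> carrier (Out (F n)). \<forall>\<phi> \<in> \<Phi>.
      (\<forall>v \<in> carrier (F n).
         act \<Phi> (Vertex (conj_class (F n) v)) = Vertex (conj_class (F n) (\<phi> v))) \<and>
      (\<forall>v \<in> carrier (F n). \<forall>\<alpha> \<in> carrier (F n). \<forall>w \<in> carrier (F n).
         (conj_class (F n) v, conj_class (F n) \<alpha>, conj_class (F n) w) \<in> arcs (SC n) \<longrightarrow>
           (conj_class (F n) (\<phi> v), conj_class (F n) (\<phi> \<alpha>), conj_class (F n) (\<phi> w)) \<in> arcs (SC n) \<and>
           (\<forall>t \<in> {0..1}.
              act \<Phi> (arc_point (SC n) (conj_class (F n) v, conj_class (F n) \<alpha>, conj_class (F n) w) t) =
              arc_point (SC n) (conj_class (F n) (\<phi> v), conj_class (F n) (\<phi> \<alpha>), conj_class (F n) (\<phi> w)) t)))"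
  by (rule group.Out_acts_on_separability_complex[OF group_free_group])

end
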